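(* Let $s\ge 2$. Let $\overline K_k\in\mathbb{R}^{m\times n}$ and $\overline\Phi_k\in\mathcal{V}^s$ for $k=1,\dots,N_K$ be fixed with $\alpha(\overline K_k)\le1$, $\beta(\overline\Phi_k)\le1$ and $\overline K_k\mathbf{1}=0$. Let $\overline T\in(0,T_{\max})$ be a stationary point of $T\mapsto J(T,(\overline K_k,\overline\Phi_k)_{k=1}^{N_K})$, with associated state $\overline x$ and adjoint state $\overline p$. Suppose that there exists a constant $C>0$ such that $$\int_0^1\Big\langle\overline p,\ \sum_{k=1}^{N_K}\Big(\overline T\,\overline K_k^\top D^2\overline\Phi_k(\overline K_k\overline x)(\overline K_kx,\overline K_kx)+2\overline K_k^\top D\overline\Phi_k(\overline K_k\overline x)\overline K_kx\Big)+2A^\top Ax\Big\rangle\,\mathrm{d}t+\langle x(1),x(1)\rangle\ \ge\ C\big(1+\|x\|_{H^1((0,1),\mathbb{R}^n)}^2\big)$$ for all $x\in C^1([0,1],\mathbb{R}^n)$ satisfying $x(0)=0$ and $$\dot x=\sum_{k=1}^{N_K}\Big(-\overline T\,\overline K_k^\top D\overline\Phi_k(\overline K_k\overline x)\overline K_kx-\overline K_k^\top\overline\Phi_k(\overline K_k\overline x)\Big)-\overline TA^\top Ax-A^\top(A\overline x-b).$$ Then $\overline T$ is a strict local minimum of $T\mapsto J(T,(\overline K_k,\overline\Phi_k)_{k=1}^{N_K})$.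
   Context: Fixed data: positive integers $n,m,l,N_K,N_w$; an integer $s\ge 2$; a matrix $A\in\mathbb{R}^{l\times n}$; vectors $b\in\mathbb{R}^l$ and $x_0,x_g\in\mathbb{R}^n$ (initial value and ground truth); a constant $T_{\max}>0$. $\mathbf{1}=(1,\dots,1)^\top\in\mathbb{R}^n$, and $\langle\cdot,\cdot\rangle$ is the Euclidean inner product. $\|x\|_{H^1((0,1),\mathbb{R}^n)}^2=\|x\|_{L^2}^2+\|\dot x\|_{L^2}^2$. Activation functions: fix a bounded open interval $I\subset\mathbb{R}$ and basis functions (linearly independent) $\psi_1,\dots,\psi_{N_w}\in C^s(\mathbb{R},\mathbb{R})$ with compact support in $\overline I$. Define the finite-dimensional space $$\mathcal{V}^s=\Big\{\Phi=(\phi,\dots,\phi):\mathbb{R}^m\to\mathbb{R}^m \;\Big|\; \phi=\sum_{j=1}^{N_w}w_j\psi_j,\ w\in\mathbb{R}^{N_w}\Big\},$$ where $\Phi$ acts componentwise, $\Phi(y_1,\dots,y_m)=(\phi(y_1),\dots,\phi(y_m))^\top$. $D\Phi(y)$ is the Jacobian (diagonal with entries $\phi'(y_i)$) and $D^2\Phi(y)(v,w)$ is the second derivative, with components $\phi''(y_i)v_iw_i$. $\|\cdot\|$ denotes any norm on $\mathbb{R}^{m\times n}$ and on $\mathcal{V}^s$. Constraint functions: $\alpha:\mathbb{R}^{m\times n}\to[0,\infty)$ and $\beta:\mathcal{V}^s\to[0,\infty)$ are continuously differentiable, with gradient of $\alpha$ (resp. $\beta$) non-vanishing at every point where $\alpha=1$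 (resp. $\beta=1$), and such that $\alpha(K)\to\infty$ as $\|K\|\to\infty$ and $\beta(\Phi)\to\infty$ as $\|\Phi\|\to\infty$. Cost functional: for $T\in\mathbb{R}$, $K_k\in\mathbb{R}^{m\times n}$, $\Phi_k\in\mathcal{V}^s$, $$J(T,(K_k,\Phi_k)_{k=1}^{N_K})=\tfrac12\|x(1)-x_g\|_2^2,$$ where the associated state $x\in C^1([0,1],\mathbb{R}^n)$ is the solution of $\dot x(t)=T\big(-A^\top(Ax(t)-b)-\sum_{k=1}^{N_K}K_k^\top\Phi_k(K_kx(t))\big)$ on $(0,1)$, $x(0)=x_0$. A stationary point of $T\mapsto J(T,(\overline K_k,\overline\Phi_k)_{k})$ is a point $\overline T$ where its derivative in $T$ vanishes. The state $\overline x$ is the solution of the state equation for $(\overline T,(\overline K_k,\overline\Phi_k)_k)$, and the adjoint state $\overline p\in C^1([0,1],\mathbb{R}^n)$ is the solution of $$\dot{\overline p}(t)=\sum_{k=1}^{N_K}\overline T\,\overline K_k^\top D\overline\Phi_k(\overline K_k\overline x(t))\overline K_k\overline p(t)+\overline TA^\top A\overline p(t),\qquad \overline p(1)=x_g-\overline x(1).$$ *)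

theory Defs
  imports "HOL-Analysis.Analysis"
begin

section \<open>Activation functions\<close>

definition C_k :: "nat \<Rightarrow> (real \<Rightarrow> real) \<Rightarrow> bool" where
  "C_k s f \<longleftrightarrow>
     (\<forall>j<s. \<forall>x. (deriv ^^ j) f field_differentiable at x) \<and> continuous_on UNIV ((deriv ^^ s) f)"

definition lin_indep_funs :: "nat \<Rightarrow> (nat \<Rightarrow> real \<Rightarrow> real) \<Rightarrow> bool" where
  "lin_indep_funs N \<psi> \<longleftrightarrow>
     (\<forall>w. (\<forall>x. (\<Sum>j=1..N. w j * \<psi> j x) = 0) \<longrightarrow> (\<forall>j\<in>{1..N}. w j = 0))"

definition componentwise :: "(real \<Rightarrow> real) \<Rightarrow> real ^ 'm \<Rightarrow> real ^ 'm" where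
  "componentwise \<phi> y = (\<chi> i. \<phi> (y $ i))"

text \<open>Since the basis functions are continuous with compact support, every activation function is
  bounded and continuous. Working in the type of bounded continuous functions makes the activation
  space a linear subspace of a normed space; no function is lost, see \<open>activation_space_image\<close>.\<close>

definition activation_space ::
    "nat \<Rightarrow> (nat \<Rightarrow> real \<Rightarrow> real) \<Rightarrow> ((real ^ 'm) \<Rightarrow>\<^sub>C (real ^ 'm)) set" where
  "activation_space N \<psi> =
     {\<Phi>. \<exists>w. apply_bcontfun \<Phi> = componentwise (\<lambda>r. \<Sum>j=1..N. w j * \<psi> j r)}"

lemma activation_space_image:
  fixes \<psi> :: "nat \<Rightarrow> real \<Rightarrow> real"
  assumes cont: "\<And>j. j \<in> {1..N} \<Longrightarrow> continuous_on UNIV (\<psi> j)"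
    and supp: "\<And>j. j \<in> {1..N} \<Longrightarrow> compact (closure {r. \<psi> j r \<noteq> 0})"
  shows "apply_bcontfun ` (activation_space N \<psi> :: ((real ^ 'm) \<Rightarrow>\<^sub>C (real ^ 'm)) set) =
     {componentwise (\<lambda>r. \<Sum>j=1..N. w j * \<psi> j r) | w. True}"
proof -
  have bnd: "\<exists>B. \<forall>r. \<bar>\<psi> j r\<bar> \<le> B" if j: "j \<in> {1..N}" for j
  proof -
    have "compact (\<psi> j ` closure {r. \<psi> j r \<noteq> 0})"
      by (rule compact_continuous_image[OF continuous_on_subset[OF cont[OF j]] supp[OF j]]) auto
    then obtain B where B: "\<And>r. r \<in> closure {r. \<psi> j r \<noteq> 0} \<Longrightarrow> \<bar>\<psi> j r\<bar> \<le> B"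
      using compact_imp_bounded bounded_iff by (metis image_eqI real_norm_def)
    have "\<bar>\<psi> j r\<bar> \<le> max B 0" for r
      using B[of r] closure_subset[of "{r. \<psi> j r \<noteq> 0}"] by (cases "\<psi> j r = 0") auto
    then show ?thesis by blast
  qed
  then obtain B where B: "\<And>j r. j \<in> {1..N} \<Longrightarrow> \<bar>\<psi> j r\<bar> \<le> B j" by metis
  have mem: "(componentwise (\<lambda>r. \<Sum>j=1..N. w j * \<psi> j r) :: real ^ 'm \<Rightarrow> real ^ 'm) \<in> bcontfun"
    for w
  proof -
    define \<phi> where "\<phi> = (\<lambda>r. \<Sum>j=1..N. w j * \<psi> j r)"
    have c: "continuous_on UNIV \<phi>"
      unfolding \<phi>_def by (intro continuous_intros cont) auto
    have \<phi>_bound: "\<bar>\<phi> r\<bar> \<le> (\<Sum>j=1..N. \<bar>w j\<bar> * B j)" for r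
      unfolding \<phi>_def
      by (rule order_trans[OF sum_abs]) (auto intro!: sum_mono mult_left_mono B simp: abs_mult)
    have "continuous_on UNIV (\<lambda>y :: real ^ 'm. \<phi> (y $ i))" for i
      by (rule continuous_on_compose2[OF c]) (auto intro!: continuous_intros)
    then have "continuous_on UNIV (componentwise \<phi> :: real ^ 'm \<Rightarrow> real ^ 'm)"
      unfolding componentwise_def by (intro continuous_on_vec_lambda)
    moreover have "norm (componentwise \<phi> y) \<le> (\<Sum>i\<in>(UNIV :: 'm set). \<Sum>j=1..N. \<bar>w j\<bar> * B j)"
      for y :: "real ^ 'm"
      by (rule order_trans[OF norm_le_l1_cart])
        (auto intro!: sum_mono \<phi>_bound[unfolded One_nat_def] simp: componentwise_def simp del: sum_constant)
    then have "bounded (range (componentwise \<phi> :: real ^ 'm \<Rightarrow> real ^ 'm))"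
      by (auto simp: bounded_iff simp del: sum_constant)
    ultimately show ?thesis by (simp add: bcontfun_def \<phi>_def)
  qed
  have "\<exists>\<Phi>. apply_bcontfun \<Phi> =
      (componentwise (\<lambda>r. \<Sum>j=1..N. w j * \<psi> j r) :: real ^ 'm \<Rightarrow> real ^ 'm)" for w
    using Bcontfun_inverse[OF mem[of w]] by blast
  then show ?thesis
    unfolding activation_space_def image_def by (safe; simp; metis)
qed

text \<open>The bilinear map \<open>D\<^sup>2\<Phi>(y)(v, w)\<close>.\<close>

definition second_derivative ::
    "(real ^ 'm \<Rightarrow> real ^ 'm) \<Rightarrow> real ^ 'm \<Rightarrow> real ^ 'm \<Rightarrow> real ^ 'm \<Rightarrow> real ^ 'm" where
  "second_derivative \<Phi> y v w =
     frechet_derivative (\<lambda>z. frechet_derivative \<Phi> (at z) v) (at y) w"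


section \<open>Constraint functions\<close>

definition norm_on :: "'a::real_vector set \<Rightarrow> ('a \<Rightarrow> real) \<Rightarrow> bool" where
  "norm_on V nrm \<longleftrightarrow>
     (\<forall>u\<in>V. 0 \<le> nrm u \<and> (nrm u = 0 \<longleftrightarrow> u = 0)) \<and>
     (\<forall>u\<in>V. \<forall>c. nrm (c *\<^sub>R u) = \<bar>c\<bar> * nrm u) \<and>
     (\<forall>u\<in>V. \<forall>v\<in>V. nrm (u + v) \<le> nrm u + nrm v)"

text \<open>To be used for a finite-dimensional linear subspace \<open>V\<close>. Continuous differentiability does not
  depend on the norm there, so it is stated with the ambient one; \<open>f' u\<close> is determined by \<open>f\<close> only on
  \<open>V\<close>, which is why the gradient is tested against directions in \<open>V\<close>. Growth at infinity is measured
  in the given norm \<open>nrm\<close>.\<close>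

definition constraint_function ::
    "'a::real_normed_vector set \<Rightarrow> ('a \<Rightarrow> real) \<Rightarrow> ('a \<Rightarrow> real) \<Rightarrow> bool" where
  "constraint_function V nrm f \<longleftrightarrow>
     (\<forall>u\<in>V. 0 \<le> f u) \<and>
     (\<exists>f' :: 'a \<Rightarrow> 'a \<Rightarrow>\<^sub>L real.
        (\<forall>u\<in>V. (f has_derivative blinfun_apply (f' u)) (at u within V)) \<and>
        continuous_on V f' \<and>
        (\<forall>u\<in>V. f u = 1 \<longrightarrow> (\<exists>h\<in>V. blinfun_apply (f' u) h \<noteq> 0))) \<and>
     filterlim f at_top (inf (filtercomap nrm at_top) (principal V))"


section \<open>State and adjoint equations\<close>

text \<open>One-sided derivatives are used at the end points.\<close>

definition C1_01 :: "(real \<Rightarrow> 'a::real_normed_vector) \<Rightarrow> bool" where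
  "C1_01 x \<longleftrightarrow>
     (\<exists>x'. (\<forall>t\<in>{0..1}. (x has_vector_derivative x' t) (at t within {0..1})) \<and>
           continuous_on {0..1} x')"

definition H1_norm :: "(real \<Rightarrow> 'a::real_normed_vector) \<Rightarrow> real" where
  "H1_norm x = sqrt (integral {0..1} (\<lambda>t. (norm (x t))\<^sup>2) +
     integral {0..1} (\<lambda>t. (norm (vector_derivative x (at t within {0..1})))\<^sup>2))"

definition is_state ::
    "real ^ 'n ^ 'l \<Rightarrow> real ^ 'l \<Rightarrow> real ^ 'n \<Rightarrow> nat \<Rightarrow>
     (nat \<Rightarrow> real ^ 'n ^ 'm) \<Rightarrow> (nat \<Rightarrow> (real ^ 'm) \<Rightarrow>\<^sub>C (real ^ 'm)) \<Rightarrow> real \<Rightarrow>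
     (real \<Rightarrow> real ^ 'n) \<Rightarrow> bool"
  where
  "is_state A b x0 NK K \<Phi> T x \<longleftrightarrow>
     C1_01 x \<and> x 0 = x0 \<and>
     (\<forall>t\<in>{0<..<1}. (x has_vector_derivative
        T *\<^sub>R (- (transpose A *v (A *v x t - b))
             - (\<Sum>k=1..NK. transpose (K k) *v \<Phi> k (K k *v x t)))) (at t))"

text \<open>The state is unique on \<open>[0, 1]\<close> but its values outside are unconstrained, hence the choice
  operator; the cost only sees the value at \<open>1\<close>.\<close>

definition cost ::
    "real ^ 'n ^ 'l \<Rightarrow> real ^ 'l \<Rightarrow> real ^ 'n \<Rightarrow> real ^ 'n \<Rightarrow> nat \<Rightarrow>
     (nat \<Rightarrow> real ^ 'n ^ 'm) \<Rightarrow> (nat \<Rightarrow> (real ^ 'm) \<Rightarrow>\<^sub>C (real ^ 'm)) \<Rightarrow> real \<Rightarrow> real"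
  where
  "cost A b x0 xg NK K \<Phi> T =
     1 / 2 * (norm ((SOME x. is_state A b x0 NK K \<Phi> T x) 1 - xg))\<^sup>2"

definition is_adjoint_state ::
    "real ^ 'n ^ 'l \<Rightarrow> real ^ 'n \<Rightarrow> nat \<Rightarrow> (nat \<Rightarrow> real ^ 'n ^ 'm) \<Rightarrow>
     (nat \<Rightarrow> (real ^ 'm) \<Rightarrow>\<^sub>C (real ^ 'm)) \<Rightarrow> real \<Rightarrow>
     (real \<Rightarrow> real ^ 'n) \<Rightarrow> (real \<Rightarrow> real ^ 'n) \<Rightarrow> bool"
  where
  "is_adjoint_state A xg NK K \<Phi> T x p \<longleftrightarrow>
     C1_01 p \<and> p 1 = xg - x 1 \<and>
     (\<forall>t\<in>{0<..<1}. (p has_vector_derivative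
        (\<Sum>k=1..NK. T *\<^sub>R (transpose (K k) *v
            (jacobian (\<Phi> k) (at (K k *v x t)) *v (K k *v p t))))
        + T *\<^sub>R (transpose A *v (A *v p t))) (at t))"

text \<open>The derivative of the state \<open>xbar\<close> with respect to the final time \<open>T\<close>.\<close>

definition is_linearized_state ::
    "real ^ 'n ^ 'l \<Rightarrow> real ^ 'l \<Rightarrow> nat \<Rightarrow> (nat \<Rightarrow> real ^ 'n ^ 'm) \<Rightarrow>
     (nat \<Rightarrow> (real ^ 'm) \<Rightarrow>\<^sub>C (real ^ 'm)) \<Rightarrow> real \<Rightarrow>
     (real \<Rightarrow> real ^ 'n) \<Rightarrow> (real \<Rightarrow> real ^ 'n) \<Rightarrow> bool"
  where
  "is_linearized_state A b NK K \<Phi> T xbar x \<longleftrightarrow>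
     C1_01 x \<and> x 0 = 0 \<and>
     (\<forall>t\<in>{0<..<1}. (x has_vector_derivative
        (\<Sum>k=1..NK.
            - (T *\<^sub>R (transpose (K k) *v
                (jacobian (\<Phi> k) (at (K k *v xbar t)) *v (K k *v x t))))
            - transpose (K k) *v \<Phi> k (K k *v xbar t))
        - T *\<^sub>R (transpose A *v (A *v x t))
        - transpose A *v (A *v xbar t - b)) (at t))"

end

theory Submission
  imports Defs
begin

text \<open>The state equation is autonomous, so the time horizon only rescales time: if \<open>X\<close> is
  the trajectory of the vector field \<open>f\<close> (\<open>state_field\<close>) that starts at the initial value,
  then the state for the horizon \<open>T\<close> is \<open>t \<mapsto> X (T * t)\<close>, and the cost is
  \<open>J T = (norm (X T - xg))\<^sup>2 / 2\<close>. Hence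
  \<open>J' T = (X T - xg) \<bullet> f (X T)\<close>, and
  \<open>J'' T = (X T - xg) \<bullet> Df (X T) (f (X T)) + f (X T) \<bullet> f (X T)\<close>. It remains to see that
  the quadratic form of the hypothesis, at a suitable linearised state, equals \<open>J'' Tbar\<close>.

  Differentiating \<open>X (T * t)\<close> in \<open>T\<close> shows that \<open>z t = t f (X (T * t))\<close> solves the
  linearised state equation and that
  \<open>y t = t\<^sup>2 Df (X (T * t)) (f (X (T * t)))\<close>, the second derivative of the state in \<open>T\<close>,
  satisfies \<open>y' = T D2f (z, z) + 2 Df z + T Df y\<close> with \<open>y 0 = 0\<close>. The adjoint state solves
  \<open>p' = - T (Df)\<^sup>* p\<close>, so \<open>(p \<bullet> y)' = p \<bullet> (T D2f (z, z) + 2 Df z)\<close>. Integration over the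
  unit interval (\<open>adjoint_pairing\<close>) and \<open>p 1 = xg - X Tbar\<close> turn the integral of the
  hypothesis into \<open>(X Tbar - xg) \<bullet> y 1\<close>, while \<open>z 1 \<bullet> z 1\<close> is the other term of
  \<open>J'' Tbar\<close>. So \<open>J'' Tbar \<ge> C > 0\<close>, and the classical test
  (\<open>strict_local_min_if_second_derivative_pos\<close>) applies.

  All this presupposes that \<open>X\<close> exists beyond \<open>Tbar\<close> and that states are unique, since the cost
  is defined by a choice among the states. Compact support makes the activation functions, and with
  them \<open>f\<close>, globally Lipschitz, so both follow from
  \<open>lipschitz_ode_exists\<close> and \<open>lipschitz_ode_unique\<close>.\<close>

section \<open>Second derivative test on the real line\<close>

text \<open>Being increasing at \<open>T0\<close>, the derivative is negative to the left and positive to the right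
  of its zero \<open>T0\<close>; the mean value theorem transfers these signs to \<open>J\<close>.\<close>

lemma strict_local_min_if_second_derivative_pos:
  fixes J g :: "real \<Rightarrow> real"
  assumes J: "\<forall>\<^sub>F T in nhds T0. (J has_real_derivative g T) (at T)"
    and g0: "g T0 = 0" and g: "(g has_real_derivative c) (at T0)" and c: "c > 0"
  shows "\<forall>\<^sub>F T in at T0. J T0 < J T"
proof -
  obtain d0 where d0: "d0 > 0" "\<And>T. dist T T0 < d0 \<Longrightarrow> (J has_real_derivative g T) (at T)"
    using J unfolding eventually_nhds_metric by blast
  obtain d1 where d1: "d1 > 0" "\<And>h. h > 0 \<Longrightarrow> h < d1 \<Longrightarrow> g T0 < g (T0 + h)"
    using DERIV_pos_inc_right[OF g c] by blast
  obtain d2 where d2: "d2 > 0" "\<And>h. h > 0 \<Longrightarrow> h < d2 \<Longrightarrow> g (T0 - h) < g T0"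
    using DERIV_pos_inc_left[OF g c] by blast
  define d where "d = min d0 (min d1 d2)"
  have "J T0 < J T" if T: "T \<noteq> T0" "dist T T0 < d" for T
  proof (cases "T0 < T")
    case True
    have "\<exists>\<xi>. T0 < \<xi> \<and> \<xi> < T \<and> J T - J T0 = (T - T0) * g \<xi>"
      by (rule MVT2[OF True]) (use T in \<open>auto intro!: d0(2) simp: d_def dist_real_def\<close>)
    then obtain \<xi> where \<xi>: "T0 < \<xi>" "\<xi> < T" "J T - J T0 = (T - T0) * g \<xi>" by blast
    have "0 < g \<xi>" using d1(2)[of "\<xi> - T0"] \<xi> T g0 by (simp add: d_def dist_real_def)
    with \<xi> True show ?thesis by (metis diff_gt_0_iff_gt mult_pos_pos)
  next
    case False
    with T have less: "T < T0" by simp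
    have "\<exists>\<xi>. T < \<xi> \<and> \<xi> < T0 \<and> J T0 - J T = (T0 - T) * g \<xi>"
      by (rule MVT2[OF less]) (use T in \<open>auto intro!: d0(2) simp: d_def dist_real_def\<close>)
    then obtain \<xi> where \<xi>: "T < \<xi>" "\<xi> < T0" "J T0 - J T = (T0 - T) * g \<xi>" by blast
    have "g \<xi> < 0" using d2(2)[of "T0 - \<xi>"] \<xi> T g0 by (simp add: d_def dist_real_def)
    with \<xi> less show ?thesis by (metis diff_gt_0_iff_gt diff_less_0_iff_less mult_pos_neg)
  qed
  moreover have "d > 0" using d0 d1 d2 by (simp add: d_def)
  ultimately show ?thesis unfolding eventually_at by blast
qed

section \<open>Ordinary differential equations with a Lipschitz right-hand side\<close>

text \<open>The weight \<open>exp (- 2 * M * t)\<close> is the integrating factor of Gronwall's inequality: it makes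
  the squared distance of two solutions nonincreasing.\<close>

lemma lipschitz_ode_unique:
  fixes x y :: "real \<Rightarrow> 'a::real_inner"
  assumes F: "M-lipschitz_on UNIV F"
    and cont: "continuous_on {0..b} x" "continuous_on {0..b} y"
    and x: "\<And>t. t \<in> {0<..<b} \<Longrightarrow> (x has_vector_derivative F (x t)) (at t)"
    and y: "\<And>t. t \<in> {0<..<b} \<Longrightarrow> (y has_vector_derivative F (y t)) (at t)"
    and "x 0 = y 0" and t: "t \<in> {0..b}"
  shows "x t = y t"
proof -
  define d where "d = (\<lambda>t. x t - y t)"
  define q where "q = (\<lambda>t. exp (- 2 * M * t) * (d t \<bullet> d t))"
  have "q t \<le> q 0"
  proof (rule DERIV_nonpos_imp_decreasing_open[where f = q and a = 0 and b = t])
    show "0 \<le> t" using t by simp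
    show "continuous_on {0..t} q"
      unfolding q_def d_def using t
      by (intro continuous_intros continuous_on_subset[OF cont(1)] continuous_on_subset[OF cont(2)]) auto
    fix r assume r: "0 < r" "r < t"
    define d' where "d' = F (x r) - F (y r)"
    have "(d has_vector_derivative d') (at r)"
      unfolding d_def d'_def using r t by (intro derivative_intros x y) auto
    then have "(d has_derivative (\<lambda>h. h *\<^sub>R d')) (at r)"
      by (simp add: has_vector_derivative_def)
    from has_derivative_inner[OF this this]
    have "((\<lambda>t. d t \<bullet> d t) has_derivative (\<lambda>h. d r \<bullet> (h *\<^sub>R d') + (h *\<^sub>R d') \<bullet> d r)) (at r)" .
    then have "((\<lambda>t. d t \<bullet> d t) has_real_derivative 2 * (d r \<bullet> d')) (at r)"
      unfolding has_field_derivative_def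
      by (rule has_derivative_eq_rhs) (auto simp: inner_commute algebra_simps)
    then have q': "(q has_real_derivative
        exp (- 2 * M * r) * (2 * (d r \<bullet> d') - 2 * M * (d r \<bullet> d r))) (at r)"
      unfolding q_def by (auto intro!: derivative_eq_intros simp: algebra_simps)
    have "d r \<bullet> d' \<le> norm (d r) * norm d'" by (rule norm_cauchy_schwarz)
    also have "\<dots> \<le> norm (d r) * (M * norm (d r))"
      unfolding d'_def d_def by (intro mult_left_mono lipschitz_on_normD[OF F]) auto
    also have "\<dots> = M * (d r \<bullet> d r)" by (simp add: dot_square_norm power2_eq_square)
    finally have "exp (- 2 * M * r) * (2 * (d r \<bullet> d') - 2 * M * (d r \<bullet> d r)) \<le> 0"
      by (intro mult_nonneg_nonpos) auto
    with q' show "\<exists>y. (q has_real_derivative y) (at r) \<and> y \<le> 0" by blast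
  qed
  also have "q 0 = 0" by (simp add: q_def d_def \<open>x 0 = y 0\<close>)
  finally have "d t \<bullet> d t \<le> 0" by (simp add: q_def mult_le_0_iff)
  then have "d t \<bullet> d t = 0" by (intro antisym inner_ge_zero)
  then show ?thesis by (simp add: d_def)
qed

text \<open>With the weight \<open>exp (- 2 * M * t)\<close> the Picard operator contracts the sup norm by the factor
  \<open>1 / 2\<close> on an interval of any length, because
  \<open>exp (- 2 * M * t) * \<integral>\<^sub>0\<^sup>t M * exp (2 * M * s) ds \<le> 1 / 2\<close>. So a single fixed point gives the
  solution on the whole interval, without continuation from short intervals. The fixed point is taken
  among bounded continuous functions on the line; the operator ignores the argument outside the
  interval and produces functions that are constant there. In it \<open>u\<close> stands for the rescaled solution
  \<open>exp (- 2 * M * t) * X t\<close>, so that the sup norm of \<open>u\<close> is the weighted norm of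
  \<open>X\<close>.\<close>

lemma lipschitz_ode_exists:
  fixes F :: "'a::euclidean_space \<Rightarrow> 'a"
  assumes F: "L-lipschitz_on UNIV F" and R: "0 \<le> R"
  obtains X where "X 0 = x0"
    and "\<And>t. t \<in> {0..R} \<Longrightarrow> (X has_vector_derivative F (X t)) (at t within {0..R})"
proof -
  \<comment> \<open>The contraction estimate integrates \<open>exp (2 * M * s)\<close>, which needs \<open>M > 0\<close>, whereas
    \<open>L\<close> may be zero.\<close>
  define M where "M = L + 1"
  have M: "M > 0" using lipschitz_on_nonneg[OF F] by (simp add: M_def)
  have FM: "norm (F u - F v) \<le> M * norm (u - v)" for u v
    using lipschitz_on_normD[OF lipschitz_on_le[OF F, of M]] by (simp add: M_def)
  have contF: "continuous_on UNIV F" by (rule lipschitz_on_continuous_on[OF F])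
  define c where "c = (\<lambda>t. max 0 (min R t))"
  have c: "c t \<in> {0..R}" and c_id: "t \<in> {0..R} \<Longrightarrow> c t = t" for t
    using R by (auto simp: c_def)
  have contc: "continuous_on UNIV c" unfolding c_def by (intro continuous_intros)
  define h where "h = (\<lambda>u s. F (exp (2 * M * s) *\<^sub>R u s))"
  define Q where "Q = (\<lambda>u t. exp (- 2 * M * t) *\<^sub>R (x0 + integral {0..t} (h u)))"
  have conth: "continuous_on S (h (apply_bcontfun u))" for u and S :: "real set"
    unfolding h_def
    by (rule continuous_on_compose2[OF contF])
       (auto intro!: continuous_intros)
  have contQ: "continuous_on {0..R} (Q (apply_bcontfun u))" for u
    unfolding Q_def
    by (intro continuous_intros indefinite_integral_continuous_1 integrable_continuous_real conth)
  have Q_bcontfun: "(\<lambda>t. Q (apply_bcontfun u) (c t)) \<in> bcontfun" for u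
  proof -
    have "continuous_on UNIV (\<lambda>t. Q (apply_bcontfun u) (c t))"
      by (rule continuous_on_compose2[OF contQ contc]) (use c in auto)
    moreover have "bounded (Q (apply_bcontfun u) ` {0..R})"
      by (intro compact_imp_bounded compact_continuous_image contQ compact_Icc)
    then have "bounded (range (\<lambda>t. Q (apply_bcontfun u) (c t)))"
      by (rule bounded_subset) (use c in auto)
    ultimately show ?thesis by (simp add: bcontfun_def)
  qed
  define P where "P = (\<lambda>u. Bcontfun (\<lambda>t. Q (apply_bcontfun u) (c t)))"
  have P: "apply_bcontfun (P u) t = Q (apply_bcontfun u) (c t)" for u t
    unfolding P_def by (simp add: Bcontfun_inverse[OF Q_bcontfun])
  have Q_contracts: "norm (Q (apply_bcontfun u) t - Q (apply_bcontfun v) t) \<le> 1 / 2 * dist u v"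
    if t: "t \<in> {0..R}" for t and u v :: "real \<Rightarrow>\<^sub>C 'a"
  proof -
    let ?w = "\<lambda>s. M * exp (2 * M * s) * dist u v"
    have w: "(?w has_integral (exp (2 * M * t) / 2 * dist u v - exp (2 * M * 0) / 2 * dist u v)) {0..t}"
      by (rule fundamental_theorem_of_calculus)
         (use t in \<open>auto intro!: derivative_eq_intros
            simp: has_real_derivative_iff_has_vector_derivative[symmetric]\<close>)
    have int: "h (apply_bcontfun u) integrable_on {0..t}" for u
      by (intro integrable_continuous_real conth)
    have "norm (integral {0..t} (h (apply_bcontfun u)) - integral {0..t} (h (apply_bcontfun v)))
        = norm (integral {0..t} (\<lambda>s. h (apply_bcontfun u) s - h (apply_bcontfun v) s))"
      by (simp add: integral_diff int)
    also have "\<dots> \<le> integral {0..t} ?w"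
    proof (rule integral_norm_bound_integral)
      show "(\<lambda>s. h (apply_bcontfun u) s - h (apply_bcontfun v) s) integrable_on {0..t}"
        by (intro integrable_diff int)
      show "?w integrable_on {0..t}" using w by blast
      fix s
      have "norm (h (apply_bcontfun u) s - h (apply_bcontfun v) s)
          \<le> M * norm (exp (2 * M * s) *\<^sub>R u s - exp (2 * M * s) *\<^sub>R v s)"
        unfolding h_def by (rule FM)
      also have "\<dots> = M * exp (2 * M * s) * dist (u s) (v s)"
        by (simp add: dist_norm flip: scaleR_diff_right)
      also have "\<dots> \<le> ?w s" using M by (intro mult_left_mono dist_bounded) auto
      finally show "norm (h (apply_bcontfun u) s - h (apply_bcontfun v) s) \<le> ?w s" .
    qed
    also have "\<dots> \<le> exp (2 * M * t) / 2 * dist u v"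
      using integral_unique[OF w] by simp
    finally have bound: "norm (integral {0..t} (h (apply_bcontfun u))
        - integral {0..t} (h (apply_bcontfun v))) \<le> exp (2 * M * t) / 2 * dist u v" .
    have "norm (Q (apply_bcontfun u) t - Q (apply_bcontfun v) t) = exp (- 2 * M * t) *
        norm (integral {0..t} (h (apply_bcontfun u)) - integral {0..t} (h (apply_bcontfun v)))"
      by (simp add: Q_def flip: scaleR_diff_right)
    also have "\<dots> \<le> exp (- 2 * M * t) * (exp (2 * M * t) / 2 * dist u v)"
      by (intro mult_left_mono bound) auto
    also have "\<dots> = 1 / 2 * dist u v" by (simp add: exp_minus)
    finally show ?thesis .
  qed
  have "dist (P u) (P v) \<le> 1 / 2 * dist u v" for u v
    by (rule dist_bound) (use Q_contracts[OF c] in \<open>simp add: P dist_norm\<close>)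
  then have "\<exists>!u. P u = u"
    by (intro banach_fix_type[where c = "1 / 2"]) auto
  then obtain u where u: "P u = u" by blast
  define X where "X = (\<lambda>t. exp (2 * M * t) *\<^sub>R apply_bcontfun u t)"
  have X: "X t = x0 + integral {0..t} (\<lambda>s. F (X s))" if "t \<in> {0..R}" for t
  proof -
    have "apply_bcontfun u t = Q (apply_bcontfun u) t" using P[of u t] c_id[OF that] u by simp
    then have "X t = (exp (2 * M * t) * exp (- 2 * M * t)) *\<^sub>R (x0 + integral {0..t} (h u))"
      by (simp add: X_def Q_def)
    then show ?thesis by (simp add: exp_minus h_def X_def)
  qed
  show ?thesis
  proof
    show "X 0 = x0" using X[of 0] R by simp
    fix t assume t: "t \<in> {0..R}"
    have "continuous_on {0..R} (\<lambda>s. F (X s))"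
      using conth[of "{0..R}" u] by (simp add: h_def X_def)
    from integral_has_vector_derivative[OF this t]
    have "((\<lambda>t. x0 + integral {0..t} (\<lambda>s. F (X s))) has_vector_derivative F (X t)) (at t within {0..R})"
      by (auto intro!: derivative_eq_intros)
    then show "(X has_vector_derivative F (X t)) (at t within {0..R})"
      by (rule has_vector_derivative_transform[rotated 2]) (use X t in auto)
  qed
qed

section \<open>Dependence of an autonomous flow on the time scale\<close>

text \<open>Mere existence of the second directional derivatives suffices: they enter one integral only,
  and the fundamental theorem for gauge integrals evaluates it for a derivative that need not be
  continuous.\<close>

locale smooth_lipschitz_field =
  fixes f :: "'a::euclidean_space \<Rightarrow> 'a" and Df :: "'a \<Rightarrow> 'a \<Rightarrow> 'a"
    and D2f :: "'a \<Rightarrow> 'a \<Rightarrow> 'a \<Rightarrow> 'a" and L :: real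
  assumes lipschitz: "L-lipschitz_on UNIV f"
    and Df: "(f has_derivative Df x) (at x)"
    and D2f: "((\<lambda>x. Df x v) has_derivative D2f x v) (at x)"
begin

lemma linear_Df: "linear (Df x)"
  by (rule has_derivative_linear[OF Df])

lemma Df_scaleR: "Df x (r *\<^sub>R v) = r *\<^sub>R Df x v"
  by (rule linear_scale[OF linear_Df])

lemma linear_D2f: "linear (D2f x v)"
  by (rule has_derivative_linear[OF D2f])

lemma Df_expand: "Df x v = (\<Sum>i\<in>Basis. (v \<bullet> i) *\<^sub>R Df x i)"
proof -
  have "Df x v = Df x (\<Sum>i\<in>Basis. (v \<bullet> i) *\<^sub>R i)" by (simp add: euclidean_representation)
  also have "\<dots> = (\<Sum>i\<in>Basis. (v \<bullet> i) *\<^sub>R Df x i)"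
    by (simp only: linear_sum[OF linear_Df] Df_scaleR)
  finally show ?thesis .
qed

lemma D2f_expand: "D2f x v w = (\<Sum>i\<in>Basis. (v \<bullet> i) *\<^sub>R D2f x i w)"
proof -
  have "((\<lambda>x. Df x v) has_derivative (\<lambda>w. \<Sum>i\<in>Basis. (v \<bullet> i) *\<^sub>R D2f x i w)) (at x)"
    unfolding Df_expand[of _ v] by (intro derivative_intros D2f)
  from has_derivative_unique[OF D2f this] show ?thesis by (rule fun_cong)
qed

lemma D2f_scaleR: "D2f x (r *\<^sub>R v) (q *\<^sub>R w) = (r * q) *\<^sub>R D2f x v w"
proof -
  have "D2f x (r *\<^sub>R v) w = r *\<^sub>R D2f x v w"
    unfolding D2f_expand[of x "r *\<^sub>R v"] D2f_expand[of x v] by (simp add: scaleR_sum_right)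
  then show ?thesis by (simp add: linear_scale[OF linear_D2f] mult.commute)
qed

lemma f_along_curve:
  assumes "(X has_vector_derivative X') (at t within S)"
  shows "((\<lambda>t. f (X t)) has_vector_derivative Df (X t) X') (at t within S)"
  using vector_derivative_diff_chain_within[OF assms has_derivative_at_withinI[OF Df]]
  by (simp add: o_def)

text \<open>The second derivative is only assumed to exist direction by direction, and the chain rule does
  not apply to \<open>\<lambda>t. Df (X t)\<close> as a curve of operators. Expanding the moving direction in the
  basis reduces the claim to finitely many fixed directions.\<close>

lemma Df_along_curve:
  assumes X: "(X has_vector_derivative X') (at t within S)"
    and v: "(v has_vector_derivative v') (at t within S)"
  shows "((\<lambda>t. Df (X t) (v t)) has_vector_derivative D2f (X t) (v t) X' + Df (X t) v')
    (at t within S)"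
proof -
  have Di: "((\<lambda>t. Df (X t) i) has_vector_derivative D2f (X t) i X') (at t within S)" for i
    using vector_derivative_diff_chain_within[OF X has_derivative_at_withinI[OF D2f]]
    by (simp add: o_def)
  have vi: "((\<lambda>t. v t \<bullet> i) has_real_derivative v' \<bullet> i) (at t within S)" for i
    using bounded_linear.has_vector_derivative[OF bounded_linear_inner_left v]
    by (simp add: has_real_derivative_iff_has_vector_derivative)
  have "((\<lambda>t. \<Sum>i\<in>Basis. (v t \<bullet> i) *\<^sub>R Df (X t) i) has_vector_derivative
      (\<Sum>i\<in>Basis. (v t \<bullet> i) *\<^sub>R D2f (X t) i X' + (v' \<bullet> i) *\<^sub>R Df (X t) i)) (at t within S)"
    by (intro has_vector_derivative_sum has_vector_derivative_scaleR vi Di)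
  then show ?thesis
    unfolding sum.distrib D2f_expand[symmetric] Df_expand[symmetric] .
qed

end

text \<open>A trajectory on a compact interval. At the end points its derivative is one-sided, which
  suffices for the states on the unit interval.\<close>

locale flow = smooth_lipschitz_field f Df D2f L
  for f :: "'a::euclidean_space \<Rightarrow> 'a" and Df D2f L +
  fixes X :: "real \<Rightarrow> 'a" and R :: real
  assumes X: "t \<in> {0..R} \<Longrightarrow> (X has_vector_derivative f (X t)) (at t within {0..R})"
begin

lemma X_interior:
  assumes "0 < t" "t < R"
  shows "(X has_vector_derivative f (X t)) (at t)"
proof -
  have "at t within {0..R} = at t" using assms by (intro at_within_interior) simp
  with X[of t] assms show ?thesis by (metis atLeastAtMost_iff less_imp_le)
qed

lemma X_rescaled:
  assumes T: "0 \<le> T" "T \<le> R" and t: "t \<in> {0..1}"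
  shows "((\<lambda>t. X (T * t)) has_vector_derivative T *\<^sub>R f (X (T * t))) (at t within {0..1})"
proof -
  have "T * t \<le> R" if "t \<in> {0..1}" for t
    using mult_mono[of T R t 1] that T by auto
  then have "(*) T ` {0..1} \<subseteq> {0..R}" and "T * t \<in> {0..R}" using T t by auto
  then have "(X has_vector_derivative f (X (T * t))) (at (T * t) within (*) T ` {0..1})"
    using has_vector_derivative_within_subset[OF X] by blast
  moreover have "((*) T has_vector_derivative T) (at t within {0..1})"
    by (auto intro!: derivative_eq_intros simp flip: has_real_derivative_iff_has_vector_derivative)
  ultimately show ?thesis using vector_diff_chain_within by (fastforce simp: o_def)
qed

text \<open>The first and second derivatives of \<open>X (T * t)\<close> with respect to \<open>T\<close>, computed with
  \<open>X' = f X\<close>.\<close>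

definition first_variation :: "real \<Rightarrow> real \<Rightarrow> 'a" where
  "first_variation T t = t *\<^sub>R f (X (T * t))"

definition second_variation :: "real \<Rightarrow> real \<Rightarrow> 'a" where
  "second_variation T t = t\<^sup>2 *\<^sub>R Df (X (T * t)) (f (X (T * t)))"

lemma first_variation_has_derivative:
  assumes T: "0 \<le> T" "T \<le> R" and t: "t \<in> {0..1}"
  shows "(first_variation T has_vector_derivative
      f (X (T * t)) + T *\<^sub>R Df (X (T * t)) (first_variation T t))
    (at t within {0..1})"
proof -
  have "((\<lambda>t. t *\<^sub>R f (X (T * t))) has_vector_derivative
      t *\<^sub>R Df (X (T * t)) (T *\<^sub>R f (X (T * t))) + 1 *\<^sub>R f (X (T * t))) (at t within {0..1})"
    by (intro has_vector_derivative_scaleR f_along_curve X_rescaled assms DERIV_ident)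
  then show ?thesis by (simp add: first_variation_def[abs_def] Df_scaleR algebra_simps)
qed

lemma C1_first_variation:
  assumes T: "0 \<le> T" "T \<le> R"
  shows "C1_01 (first_variation T)"
proof -
  have "continuous_on {0..1} (\<lambda>t. f (X (T * t)))"
    by (rule continuous_on_vector_derivative[OF f_along_curve[OF X_rescaled[OF T]]])
  moreover have "continuous_on {0..1} (\<lambda>t. Df (X (T * t)) (first_variation T t))"
    by (rule continuous_on_vector_derivative[OF
        Df_along_curve[OF X_rescaled[OF T] first_variation_has_derivative[OF T]]])
  ultimately have "continuous_on {0..1} (\<lambda>t. f (X (T * t)) + T *\<^sub>R Df (X (T * t)) (first_variation T t))"
    by (intro continuous_intros)
  then show ?thesis
    unfolding C1_01_def
    by (intro exI[of _ "\<lambda>t. f (X (T * t)) + T *\<^sub>R Df (X (T * t)) (first_variation T t)"]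
        conjI ballI first_variation_has_derivative[OF T])
qed

lemma second_variation_has_derivative:
  assumes T: "0 \<le> T" "T \<le> R" and t: "t \<in> {0..1}"
  shows "(second_variation T has_vector_derivative
      T *\<^sub>R D2f (X (T * t)) (first_variation T t) (first_variation T t)
      + 2 *\<^sub>R Df (X (T * t)) (first_variation T t)
      + T *\<^sub>R Df (X (T * t)) (second_variation T t)) (at t within {0..1})"
proof -
  note x = X_rescaled[OF assms]
  have scaled: "D2f y v (r *\<^sub>R w) = r *\<^sub>R D2f y v w"
      "D2f y (r *\<^sub>R v) w = r *\<^sub>R D2f y v w" for y v w r
    using D2f_scaleR[of y 1 v r w] D2f_scaleR[of y r v 1 w] by simp_all
  have sq: "((\<lambda>t. t\<^sup>2) has_real_derivative 2 * t) (at t within {0..1})"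
    by (auto intro!: derivative_eq_intros)
  from has_vector_derivative_scaleR[OF sq Df_along_curve[OF x f_along_curve[OF x]]]
  show ?thesis
    by (simp add: second_variation_def[abs_def] first_variation_def scaled Df_scaleR power2_eq_square
        algebra_simps)
qed

text \<open>Differentiating the pairing of \<open>p\<close> with \<open>second_variation T\<close> produces the term
  \<open>T *\<^sub>R Df (second_variation T)\<close>, which the adjoint equation cancels. What remains is an
  expression in the first variation alone, and its integral is a boundary term.\<close>

lemma adjoint_pairing:
  assumes T: "0 \<le> T" "T \<le> R"
    and p: "continuous_on {0..1} p"
    and p': "\<And>t. t \<in> {0<..<1} \<Longrightarrow> (p has_vector_derivative p' t) (at t)"
    and adj: "\<And>t v. t \<in> {0<..<1} \<Longrightarrow> p' t \<bullet> v = - T * (p t \<bullet> Df (X (T * t)) v)"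
  shows "((\<lambda>t. p t \<bullet> (T *\<^sub>R D2f (X (T * t)) (first_variation T t) (first_variation T t)
      + 2 *\<^sub>R Df (X (T * t)) (first_variation T t)))
    has_integral p 1 \<bullet> Df (X T) (f (X T))) {0..1}"
proof -
  let ?g = "\<lambda>t. T *\<^sub>R D2f (X (T * t)) (first_variation T t) (first_variation T t)
    + 2 *\<^sub>R Df (X (T * t)) (first_variation T t)"
  have s: "continuous_on {0..1} (second_variation T)"
    by (rule continuous_on_vector_derivative[OF second_variation_has_derivative[OF T]])
  have "((\<lambda>t. p t \<bullet> ?g t) has_integral p 1 \<bullet> second_variation T 1 - p 0 \<bullet> second_variation T 0) {0..1}"
  proof (rule fundamental_theorem_of_calculus_interior)
    show "continuous_on {0..1} (\<lambda>t. p t \<bullet> second_variation T t)" by (intro continuous_intros p s)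
    fix t :: real assume t: "t \<in> {0<..<1}"
    have "at t within {0..1} = at t" using t by (intro at_within_interior) simp
    with second_variation_has_derivative[OF T, of t] t
    have "(second_variation T has_vector_derivative ?g t + T *\<^sub>R Df (X (T * t)) (second_variation T t)) (at t)"
      by (metis atLeastAtMost_iff greaterThanLessThan_iff less_imp_le)
    from bounded_bilinear.has_vector_derivative[OF bounded_bilinear_inner p'[OF t] this]
    have "((\<lambda>t. p t \<bullet> second_variation T t) has_vector_derivative
        p t \<bullet> (?g t + T *\<^sub>R Df (X (T * t)) (second_variation T t)) + p' t \<bullet> second_variation T t) (at t)" .
    then show "((\<lambda>t. p t \<bullet> second_variation T t) has_vector_derivative p t \<bullet> ?g t) (at t)"
      by (simp add: adj[OF t] inner_add_right)
  qed simp
  then show ?thesis by (simp add: second_variation_def)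
qed

lemma terminal_cost_derivative:
  assumes "0 < T" "T < R"
  shows "((\<lambda>T. 1 / 2 * (norm (X T - xg))\<^sup>2) has_real_derivative (X T - xg) \<bullet> f (X T)) (at T)"
proof -
  have "((\<lambda>T. X T - xg) has_vector_derivative f (X T)) (at T)"
    using X_interior[OF assms] by (auto intro!: derivative_eq_intros)
  from bounded_bilinear.has_vector_derivative[OF bounded_bilinear_inner this this]
  have "((\<lambda>T. (X T - xg) \<bullet> (X T - xg)) has_real_derivative 2 * ((X T - xg) \<bullet> f (X T))) (at T)"
    by (simp add: has_real_derivative_iff_has_vector_derivative inner_commute)
  from DERIV_cmult[OF this, of "1 / 2"] show ?thesis by (simp add: power2_norm_eq_inner)
qed

lemma terminal_cost_second_derivative:
  assumes "0 < T" "T < R"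
  shows "((\<lambda>T. (X T - xg) \<bullet> f (X T)) has_real_derivative
    (X T - xg) \<bullet> Df (X T) (f (X T)) + f (X T) \<bullet> f (X T)) (at T)"
proof -
  have "((\<lambda>T. X T - xg) has_vector_derivative f (X T)) (at T)"
    using X_interior[OF assms] by (auto intro!: derivative_eq_intros)
  from bounded_bilinear.has_vector_derivative[OF bounded_bilinear_inner this
      f_along_curve[OF X_interior[OF assms]]]
  show ?thesis by (simp add: has_real_derivative_iff_has_vector_derivative)
qed

end

section \<open>Activation functions\<close>

text \<open>The derivative vanishes off the support, since the function is locally zero there, and it is
  bounded on the support by compactness.\<close>

lemma compact_support_deriv_bounded:
  fixes \<psi> :: "real \<Rightarrow> real"
  assumes d: "\<And>r. (\<psi> has_real_derivative \<psi>' r) (at r)"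
    and cont: "continuous_on UNIV \<psi>'"
    and supp: "compact (closure {r. \<psi> r \<noteq> 0})"
  shows "\<exists>B\<ge>0. \<forall>r. \<bar>\<psi>' r\<bar> \<le> B"
proof -
  let ?S = "closure {r. \<psi> r \<noteq> 0}"
  have "bounded (\<psi>' ` ?S)"
    by (intro compact_imp_bounded compact_continuous_image supp continuous_on_subset[OF cont]) auto
  then obtain B where B: "B > 0" "\<And>r. r \<in> ?S \<Longrightarrow> \<bar>\<psi>' r\<bar> \<le> B"
    unfolding bounded_pos by auto
  have zero: "\<psi>' r = 0" if "r \<notin> ?S" for r
  proof -
    have "((\<lambda>_. 0) has_real_derivative \<psi>' r) (at r)"
      by (rule has_field_derivative_transform_within_open[OF d, of "- ?S"])
         (use that closure_subset[of "{r. \<psi> r \<noteq> 0}"] in auto)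
    then show ?thesis using DERIV_unique DERIV_const by blast
  qed
  have "\<bar>\<psi>' r\<bar> \<le> B" for r
    using B zero by (cases "r \<in> ?S") auto
  then show ?thesis using B(1) by (intro exI[of _ B]) auto
qed

lemma activation_profile:
  assumes \<Phi>: "\<Phi> \<in> activation_space N \<psi>" and s: "s \<ge> 2"
    and C: "\<forall>j\<in>{1..N}. C_k s (\<psi> j)"
    and supp: "\<forall>j\<in>{1..N}. compact (closure {r. \<psi> j r \<noteq> 0})"
  obtains \<phi> \<phi>' \<phi>'' B where "apply_bcontfun \<Phi> = componentwise \<phi>"
    and "\<And>r. (\<phi> has_real_derivative \<phi>' r) (at r)"
    and "\<And>r. (\<phi>' has_real_derivative \<phi>'' r) (at r)"
    and "B \<ge> 0" and "\<And>r. \<bar>\<phi>' r\<bar> \<le> B"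
proof -
  obtain w where w: "apply_bcontfun \<Phi> = componentwise (\<lambda>r. \<Sum>j=1..N. w j * \<psi> j r)"
    using \<Phi> by (auto simp: activation_space_def)
  have diff: "(deriv ^^ i) (\<psi> j) field_differentiable at r" if "j \<in> {1..N}" "i < 2" for i j r
    using C s that unfolding C_k_def by (meson less_le_trans)
  have d1: "(\<psi> j has_real_derivative deriv (\<psi> j) r) (at r)" if "j \<in> {1..N}" for j r
    using diff[OF that, of 0 r] by (simp add: DERIV_deriv_iff_field_differentiable)
  have d2: "(deriv (\<psi> j) has_real_derivative deriv (deriv (\<psi> j)) r) (at r)"
    if "j \<in> {1..N}" for j r
    using diff[OF that, of 1 r] by (simp add: DERIV_deriv_iff_field_differentiable)
  have "\<exists>B\<ge>0. \<forall>r. \<bar>deriv (\<psi> j) r\<bar> \<le> B" if j: "j \<in> {1..N}" for j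
  proof (rule compact_support_deriv_bounded)
    show "continuous_on UNIV (deriv (\<psi> j))"
      using d2[OF j] by (intro DERIV_continuous_on) (auto intro: has_field_derivative_at_within)
  qed (use d1 supp j in auto)
  then obtain B where B: "\<And>j. j \<in> {1..N} \<Longrightarrow> B j \<ge> 0"
    "\<And>j r. j \<in> {1..N} \<Longrightarrow> \<bar>deriv (\<psi> j) r\<bar> \<le> B j"
    by metis
  show ?thesis
  proof (rule that[OF w])
    show "((\<lambda>r. \<Sum>j=1..N. w j * \<psi> j r) has_real_derivative (\<Sum>j=1..N. w j * deriv (\<psi> j) r)) (at r)" for r
      by (intro DERIV_sum DERIV_cmult d1)
    show "((\<lambda>r. \<Sum>j=1..N. w j * deriv (\<psi> j) r) has_real_derivative
        (\<Sum>j=1..N. w j * deriv (deriv (\<psi> j)) r)) (at r)" for r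
      by (intro DERIV_sum DERIV_cmult d2)
    show "(\<Sum>j=1..N. \<bar>w j\<bar> * B j) \<ge> 0" by (intro sum_nonneg mult_nonneg_nonneg B) auto
    show "\<bar>\<Sum>j=1..N. w j * deriv (\<psi> j) r\<bar> \<le> (\<Sum>j=1..N. \<bar>w j\<bar> * B j)" for r
    proof (rule order_trans[OF sum_abs], rule sum_mono)
      fix j assume "j \<in> {1..N}"
      then show "\<bar>w j * deriv (\<psi> j) r\<bar> \<le> \<bar>w j\<bar> * B j"
        unfolding abs_mult by (intro mult_left_mono B) auto
    qed
  qed
qed

lemma componentwise_has_derivative:
  fixes g :: "'m::finite \<Rightarrow> real \<Rightarrow> real" and y :: "real ^ 'm"
  assumes "\<And>i. (g i has_real_derivative g' i) (at (y $ i))"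
  shows "((\<lambda>y. \<chi> i. g i (y $ i)) has_derivative (\<lambda>h. \<chi> i. g' i * h $ i)) (at y)"
proof -
  have "((\<lambda>y. g i (y $ i)) has_derivative (\<lambda>h. g' i * h $ i)) (at y)" for i
  proof -
    have "((\<lambda>y. y $ i) has_derivative (\<lambda>h. h $ i)) (at y)"
      by (intro bounded_linear.has_derivative[OF bounded_linear_vec_nth] has_derivative_ident)
    from has_derivative_compose[OF this assms[of i, unfolded has_field_derivative_def]]
    show ?thesis .
  qed
  then show ?thesis
    by (subst has_derivative_componentwise_within) (auto simp: Basis_vec_def inner_axis)
qed

text \<open>The first and second derivatives of a componentwise map are diagonal, with the derivatives of its
  profile on the diagonal. This gives the existence of the Jacobian and of \<open>second_derivative\<close>, the symmetry of
  the Jacobian, and a Lipschitz bound.\<close>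

lemma activation_function_smooth:
  fixes \<Phi> :: "(real ^ 'm) \<Rightarrow>\<^sub>C (real ^ 'm)"
  assumes \<Phi>: "\<Phi> \<in> activation_space N \<psi>" and s: "s \<ge> 2"
    and C: "\<forall>j\<in>{1..N}. C_k s (\<psi> j)"
    and supp: "\<forall>j\<in>{1..N}. compact (closure {r. \<psi> j r \<noteq> 0})"
  shows "(\<Phi> has_derivative (\<lambda>v. jacobian \<Phi> (at y) *v v)) (at y)"
    and "((\<lambda>z. jacobian \<Phi> (at z) *v v) has_derivative second_derivative \<Phi> y v) (at y)"
    and "(jacobian \<Phi> (at y) *v v) \<bullet> w = v \<bullet> (jacobian \<Phi> (at y) *v w)"
    and "\<exists>B. B-lipschitz_on UNIV \<Phi>"
proof -
  obtain \<phi> \<phi>' \<phi>'' B where \<phi>: "apply_bcontfun \<Phi> = componentwise \<phi>"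
    and d1: "\<And>r. (\<phi> has_real_derivative \<phi>' r) (at r)"
    and d2: "\<And>r. (\<phi>' has_real_derivative \<phi>'' r) (at r)"
    and B: "B \<ge> 0" "\<And>r. \<bar>\<phi>' r\<bar> \<le> B"
    using activation_profile[OF assms] by metis
  have D: "(\<Phi> has_derivative (\<lambda>v. \<chi> i. \<phi>' (y $ i) * v $ i)) (at y)" for y
    unfolding \<phi> componentwise_def by (rule componentwise_has_derivative) (rule d1)
  show J: "(\<Phi> has_derivative (\<lambda>v. jacobian \<Phi> (at y) *v v)) (at y)" for y
    using D[of y] jacobian_works differentiable_def by blast
  have J_eq: "jacobian \<Phi> (at y) *v v = (\<chi> i. \<phi>' (y $ i) * v $ i)" for y v
    using has_derivative_unique[OF J D] by (rule fun_cong)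
  show "(jacobian \<Phi> (at y) *v v) \<bullet> w = v \<bullet> (jacobian \<Phi> (at y) *v w)"
    unfolding J_eq by (simp add: inner_vec_def mult.commute mult.left_commute)
  have "((\<lambda>z. jacobian \<Phi> (at z) *v v) has_derivative (\<lambda>w. \<chi> i. (\<phi>'' (y $ i) * v $ i) * w $ i)) (at y)"
    unfolding J_eq
    by (rule componentwise_has_derivative[where g = "\<lambda>i r. \<phi>' r * v $ i"])
       (auto intro!: derivative_eq_intros d2)
  then have "((\<lambda>z. jacobian \<Phi> (at z) *v v) has_derivative
      frechet_derivative (\<lambda>z. jacobian \<Phi> (at z) *v v) (at y)) (at y)"
    using frechet_derivative_works differentiable_def by blast
  moreover have "frechet_derivative \<Phi> (at z) v = jacobian \<Phi> (at z) *v v" for z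
    using frechet_derivative_at[OF J] by metis
  ultimately show "((\<lambda>z. jacobian \<Phi> (at z) *v v) has_derivative second_derivative \<Phi> y v) (at y)"
    by (simp add: second_derivative_def[abs_def])
  have \<phi>_lipschitz: "\<bar>\<phi> a - \<phi> c\<bar> \<le> B * \<bar>a - c\<bar>" for a c
    using field_differentiable_bound[of UNIV \<phi> \<phi>' B a c] d1 B by auto
  have "B-lipschitz_on UNIV \<Phi>"
  proof (rule lipschitz_onI)
    fix x y :: "real ^ 'm"
    have "norm (\<Phi> x - \<Phi> y) \<le> norm (B *\<^sub>R (x - y))"
      by (rule norm_le_componentwise_cart) (use \<phi>_lipschitz B in \<open>simp add: \<phi> componentwise_def abs_mult\<close>)
    then show "dist (\<Phi> x) (\<Phi> y) \<le> B * dist x y" using B by (simp add: dist_norm)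
  qed (rule B)
  then show "\<exists>B. B-lipschitz_on UNIV \<Phi>" by blast
qed

section \<open>The vector field of the state equation\<close>

definition state_field ::
    "real ^ 'n ^ 'l \<Rightarrow> real ^ 'l \<Rightarrow> nat \<Rightarrow> (nat \<Rightarrow> real ^ 'n ^ 'm) \<Rightarrow>
     (nat \<Rightarrow> (real ^ 'm) \<Rightarrow>\<^sub>C (real ^ 'm)) \<Rightarrow> real ^ 'n \<Rightarrow> real ^ 'n"
  where
  "state_field A b NK K \<Phi> x =
     - (transpose A *v (A *v x - b)) - (\<Sum>k=1..NK. transpose (K k) *v \<Phi> k (K k *v x))"

definition state_field_D ::
    "real ^ 'n ^ 'l \<Rightarrow> nat \<Rightarrow> (nat \<Rightarrow> real ^ 'n ^ 'm) \<Rightarrow>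
     (nat \<Rightarrow> (real ^ 'm) \<Rightarrow>\<^sub>C (real ^ 'm)) \<Rightarrow> real ^ 'n \<Rightarrow> real ^ 'n \<Rightarrow> real ^ 'n"
  where
  "state_field_D A NK K \<Phi> x v =
     - (transpose A *v (A *v v))
     - (\<Sum>k=1..NK. transpose (K k) *v (jacobian (\<Phi> k) (at (K k *v x)) *v (K k *v v)))"

definition state_field_D2 ::
    "nat \<Rightarrow> (nat \<Rightarrow> real ^ 'n ^ 'm) \<Rightarrow> (nat \<Rightarrow> (real ^ 'm) \<Rightarrow>\<^sub>C (real ^ 'm)) \<Rightarrow>
     real ^ 'n \<Rightarrow> real ^ 'n \<Rightarrow> real ^ 'n \<Rightarrow> real ^ 'n"
  where
  "state_field_D2 NK K \<Phi> x v w =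
     - (\<Sum>k=1..NK. transpose (K k) *v second_derivative (\<Phi> k) (K k *v x) (K k *v v) (K k *v w))"

lemma inner_transpose: "(transpose M *v u) \<bullet> v = u \<bullet> ((M :: real ^ 'n ^ 'm) *v v)"
  by (simp add: transpose_matrix_vector dot_lmul_matrix)

text \<open>Up to the factor \<open>T\<close>, the right-hand side of the adjoint equation is minus the transpose of
  the derivative of the field; this rests on the symmetry of the Jacobians.\<close>

lemma state_field_D_adjoint:
  fixes A :: "real ^ 'n ^ 'l" and K :: "nat \<Rightarrow> real ^ 'n ^ 'm" and \<Phi> :: "nat \<Rightarrow> (real ^ 'm) \<Rightarrow>\<^sub>C (real ^ 'm)"
  assumes "\<And>k y v w. k \<in> {1..NK} \<Longrightarrow>
    (jacobian (\<Phi> k) (at y) *v v) \<bullet> w = v \<bullet> (jacobian (\<Phi> k) (at y) *v w)"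
  shows "((\<Sum>k=1..NK. transpose (K k) *v (jacobian (\<Phi> k) (at (K k *v x)) *v (K k *v p)))
      + transpose A *v (A *v p)) \<bullet> v = - (p \<bullet> state_field_D A NK K \<Phi> x v)"
proof -
  have M: "p \<bullet> (transpose M *v u) = (M *v p) \<bullet> u" for M :: "real ^ 'n ^ 'k" and u
    by (metis inner_commute inner_transpose)
  have "(\<Sum>k=1..NK. transpose (K k) *v (jacobian (\<Phi> k) (at (K k *v x)) *v (K k *v p))) \<bullet> v
     = p \<bullet> (\<Sum>k=1..NK. transpose (K k) *v (jacobian (\<Phi> k) (at (K k *v x)) *v (K k *v v)))"
    unfolding inner_sum_left inner_sum_right inner_transpose M
    by (intro sum.cong refl assms)
  moreover have "(transpose A *v (A *v p)) \<bullet> v = p \<bullet> (transpose A *v (A *v v))"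
    by (simp only: inner_transpose M)
  ultimately show ?thesis
    by (simp add: state_field_D_def inner_add_left inner_diff_right)
qed

lemma lipschitz_on_sum:
  fixes g :: "'i \<Rightarrow> 'a::metric_space \<Rightarrow> 'b::real_normed_vector"
  assumes "finite S" and "\<And>k. k \<in> S \<Longrightarrow> (B k)-lipschitz_on U (g k)"
  shows "(\<Sum>k\<in>S. B k)-lipschitz_on U (\<lambda>x. \<Sum>k\<in>S. g k x)"
  using assms
proof (induction S rule: finite_induct)
  case empty
  then show ?case by (simp add: lipschitz_on_constant)
next
  case (insert k S)
  then show ?case by (simp add: lipschitz_on_add)
qed

lemma lipschitz_matrix_vector:
  fixes M :: "real ^ 'n ^ 'm"
  shows "(onorm ((*v) M))-lipschitz_on U ((*v) M)"
proof (rule lipschitz_onI)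
  fix x y :: "real ^ 'n"
  have "norm (M *v (x - y)) \<le> onorm ((*v) M) * norm (x - y)"
    by (rule onorm[OF matrix_vector_mul_bounded_linear])
  then show "dist (M *v x) (M *v y) \<le> onorm ((*v) M) * dist x y"
    by (simp add: dist_norm matrix_vector_mult_diff_distrib)
qed (rule onorm_pos_le[OF matrix_vector_mul_bounded_linear])

lemma smooth_lipschitz_state_field:
  fixes A :: "real ^ 'n ^ 'l" and K :: "nat \<Rightarrow> real ^ 'n ^ 'm" and \<Phi> :: "nat \<Rightarrow> (real ^ 'm) \<Rightarrow>\<^sub>C (real ^ 'm)"
  assumes \<Phi>: "\<And>k y. k \<in> {1..NK} \<Longrightarrow>
      (\<Phi> k has_derivative (\<lambda>v. jacobian (\<Phi> k) (at y) *v v)) (at y)"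
    and \<Phi>': "\<And>k y v. k \<in> {1..NK} \<Longrightarrow>
      ((\<lambda>z. jacobian (\<Phi> k) (at z) *v v) has_derivative second_derivative (\<Phi> k) y v) (at y)"
    and lip: "\<And>k. k \<in> {1..NK} \<Longrightarrow> \<exists>B. B-lipschitz_on UNIV (\<Phi> k)"
  shows "\<exists>L. smooth_lipschitz_field (state_field A b NK K \<Phi>) (state_field_D A NK K \<Phi>)
    (state_field_D2 NK K \<Phi>) L"
proof -
  have mv: "((\<lambda>x. M *v g x) has_derivative (\<lambda>h. M *v g' h)) (at x)"
    if "(g has_derivative g') (at x)"
    for M :: "real ^ 'p ^ 'q" and g :: "real ^ 'n \<Rightarrow> real ^ 'p" and g' x
    by (rule bounded_linear.has_derivative[OF matrix_vector_mul_bounded_linear that])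
  have mult: "((\<lambda>x. M *v x) has_derivative (\<lambda>h. M *v h)) (at x)"
    for M :: "real ^ 'n ^ 'p" and x
    by (rule bounded_linear_imp_has_derivative) simp
  have "\<exists>B. \<forall>k\<in>{1..NK}. (B k)-lipschitz_on UNIV (\<lambda>x. transpose (K k) *v \<Phi> k (K k *v x))"
  proof (rule bchoice, rule ballI)
    fix k assume "k \<in> {1..NK}"
    then obtain B where B: "B-lipschitz_on UNIV (\<Phi> k)" using lip by blast
    have "(B * onorm ((*v) (K k)))-lipschitz_on UNIV (\<lambda>x. \<Phi> k (K k *v x))"
      by (rule lipschitz_on_compose2[OF lipschitz_matrix_vector lipschitz_on_subset[OF B]]) auto
    from lipschitz_on_compose2[OF this lipschitz_matrix_vector]
    show "\<exists>B. B-lipschitz_on UNIV (\<lambda>x. transpose (K k) *v \<Phi> k (K k *v x))" by blast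
  qed
  then obtain B where B: "\<And>k. k \<in> {1..NK} \<Longrightarrow>
      (B k)-lipschitz_on UNIV (\<lambda>x. transpose (K k) *v \<Phi> k (K k *v x))" by blast
  have sum: "(\<Sum>k=1..NK. B k)-lipschitz_on UNIV
      (\<lambda>x. \<Sum>k=1..NK. transpose (K k) *v \<Phi> k (K k *v x))"
    by (intro lipschitz_on_sum B) auto
  have affine: "(onorm ((*v) (transpose A ** A)))-lipschitz_on UNIV (\<lambda>x. transpose A *v (A *v x - b))"
    using lipschitz_matrix_vector[of "transpose A ** A" UNIV]
    by (auto simp: lipschitz_on_def dist_norm matrix_vector_mult_diff_distrib matrix_vector_mul_assoc)
  obtain L where L: "L-lipschitz_on UNIV (state_field A b NK K \<Phi>)"
    using lipschitz_on_diff[OF lipschitz_on_minus[OF affine] sum]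
    unfolding state_field_def[abs_def] by blast
  have "smooth_lipschitz_field (state_field A b NK K \<Phi>) (state_field_D A NK K \<Phi>)
    (state_field_D2 NK K \<Phi>) L"
  proof
    show "L-lipschitz_on UNIV (state_field A b NK K \<Phi>)" by (rule L)
    show "(state_field A b NK K \<Phi> has_derivative state_field_D A NK K \<Phi> x) (at x)" for x
    proof -
      have "((\<lambda>x. \<Phi> k (K k *v x)) has_derivative
          (\<lambda>v. jacobian (\<Phi> k) (at (K k *v x)) *v (K k *v v))) (at x)" if "k \<in> {1..NK}" for k
        by (rule has_derivative_compose[OF mult \<Phi>[OF that]])
      moreover have "((\<lambda>x. A *v x - b) has_derivative (\<lambda>v. A *v v)) (at x)"
        using has_derivative_diff[OF mult has_derivative_const] by simp
      ultimately show ?thesis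
        unfolding state_field_def[abs_def] state_field_D_def[abs_def]
        by (intro has_derivative_diff has_derivative_minus has_derivative_sum mv)
    qed
    show "((\<lambda>x. state_field_D A NK K \<Phi> x v) has_derivative state_field_D2 NK K \<Phi> x v) (at x)" for x v
    proof -
      have "((\<lambda>x. jacobian (\<Phi> k) (at (K k *v x)) *v (K k *v v)) has_derivative
          (\<lambda>w. second_derivative (\<Phi> k) (K k *v x) (K k *v v) (K k *v w))) (at x)"
        if "k \<in> {1..NK}" for k
        by (rule has_derivative_compose[OF mult \<Phi>'[OF that]])
      then have "((\<lambda>x. state_field_D A NK K \<Phi> x v) has_derivative
          (\<lambda>w. 0 - (\<Sum>k=1..NK. transpose (K k) *v
            second_derivative (\<Phi> k) (K k *v x) (K k *v v) (K k *v w)))) (at x)"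
        unfolding state_field_D_def
        by (intro has_derivative_diff has_derivative_const has_derivative_sum mv)
      then show ?thesis by (simp add: state_field_D2_def[abs_def])
    qed
  qed
  then show ?thesis by blast
qed

lemma is_state_iff:
  "is_state A b x0 NK K \<Phi> T x \<longleftrightarrow> C1_01 x \<and> x 0 = x0 \<and>
     (\<forall>t\<in>{0<..<1}. (x has_vector_derivative T *\<^sub>R state_field A b NK K \<Phi> (x t)) (at t))"
  by (simp add: is_state_def state_field_def)

text \<open>Since the scaled trajectory is a state, the choice in the definition of \<open>cost\<close> picks a state,
  and uniqueness identifies it with the scaled trajectory on the unit interval.\<close>

lemma
  assumes "flow (state_field A b NK K \<Phi>) Df D2f L X R"
    and X0: "X 0 = x0" and T: "0 \<le> T" "T \<le> R"
  shows states_eq_flow: "is_state A b x0 NK K \<Phi> T x \<Longrightarrow> t \<in> {0..1} \<Longrightarrow> x t = X (T * t)"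
    and cost_eq_flow: "cost A b x0 xg NK K \<Phi> T = 1 / 2 * (norm (X T - xg))\<^sup>2"
proof -
  interpret flow "state_field A b NK K \<Phi>" Df D2f L X R by fact
  let ?f = "state_field A b NK K \<Phi>"
  have C1: "C1_01 (\<lambda>t. X (T * t))"
    unfolding C1_01_def
  proof (intro exI[of _ "\<lambda>t. T *\<^sub>R ?f (X (T * t))"] conjI ballI X_rescaled T)
    show "continuous_on {0..1} (\<lambda>t. T *\<^sub>R ?f (X (T * t)))"
      by (intro continuous_intros
          continuous_on_vector_derivative[OF f_along_curve[OF X_rescaled[OF T]]])
  qed
  have deriv: "((\<lambda>t. X (T * t)) has_vector_derivative T *\<^sub>R ?f (X (T * t))) (at t)"
    if "t \<in> {0<..<1}" for t
  proof -
    have "at t within {0..1} = at t" using that by (intro at_within_interior) simp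
    with X_rescaled[OF T, of t] that show ?thesis
      by (metis atLeastAtMost_iff greaterThanLessThan_iff less_imp_le)
  qed
  have continuous: "continuous_on {0..1} y" if "C1_01 y" for y :: "real \<Rightarrow> real ^ 'a"
    using that unfolding C1_01_def by (metis continuous_on_vector_derivative)
  have unique: "x t = X (T * t)" if x: "is_state A b x0 NK K \<Phi> T x" and t: "t \<in> {0..1}" for x t
  proof (rule lipschitz_ode_unique[where x = x and y = "\<lambda>t. X (T * t)"])
    show "(\<bar>T\<bar> * L)-lipschitz_on UNIV (\<lambda>y. T *\<^sub>R ?f y)"
      by (intro lipschitz_on_cmult lipschitz)
  qed (use x t deriv X0 continuous[OF C1] in \<open>auto simp: is_state_iff continuous\<close>)
  then show "is_state A b x0 NK K \<Phi> T x \<Longrightarrow> t \<in> {0..1} \<Longrightarrow> x t = X (T * t)" .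
  have "is_state A b x0 NK K \<Phi> T (\<lambda>t. X (T * t))"
    using C1 deriv X0 by (simp add: is_state_iff)
  then have "is_state A b x0 NK K \<Phi> T (SOME x. is_state A b x0 NK K \<Phi> T x)"
    by (rule someI[of "is_state A b x0 NK K \<Phi> T"])
  from unique[OF this, of 1] show "cost A b x0 xg NK K \<Phi> T = 1 / 2 * (norm (X T - xg))\<^sup>2"
    by (simp add: cost_def)
qed

section \<open>Sufficient second-order condition for the stopping time\<close>

theorem theorem2p3:
  fixes A :: "real ^ 'n ^ 'l" and b :: "real ^ 'l" and x0 xg :: "real ^ 'n"
    and Tmax :: real and s NK Nw :: nat
    and I :: "real set" and \<psi> :: "nat \<Rightarrow> real \<Rightarrow> real"
    and nrmK :: "real ^ 'n ^ 'm \<Rightarrow> real" and nrmV :: "((real ^ 'm) \<Rightarrow>\<^sub>C (real ^ 'm)) \<Rightarrow> real"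
    and \<alpha> :: "real ^ 'n ^ 'm \<Rightarrow> real" and \<beta> :: "((real ^ 'm) \<Rightarrow>\<^sub>C (real ^ 'm)) \<Rightarrow> real"
    and K :: "nat \<Rightarrow> real ^ 'n ^ 'm" and \<Phi> :: "nat \<Rightarrow> (real ^ 'm) \<Rightarrow>\<^sub>C (real ^ 'm)"
    and Tbar :: real and xbar pbar :: "real \<Rightarrow> real ^ 'n" and C :: real
  assumes "NK \<ge> 1" and "Nw \<ge> 1" and "s \<ge> 2" and "Tmax > 0"
    and "\<exists>l u. l < u \<and> I = {l<..<u}"
    and "\<forall>j\<in>{1..Nw}. C_k s (\<psi> j)"
    and "\<forall>j\<in>{1..Nw}. compact (closure {r. \<psi> j r \<noteq> 0}) \<and> closure {r. \<psi> j r \<noteq> 0} \<subseteq> closure I"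
    and "lin_indep_funs Nw \<psi>"
    and "norm_on UNIV nrmK" and "norm_on (activation_space Nw \<psi>) nrmV"
    and "constraint_function UNIV nrmK \<alpha>"
    and "constraint_function (activation_space Nw \<psi>) nrmV \<beta>"
    and "\<forall>k\<in>{1..NK}. \<Phi> k \<in> activation_space Nw \<psi>"
    and "\<forall>k\<in>{1..NK}. \<alpha> (K k) \<le> 1 \<and> \<beta> (\<Phi> k) \<le> 1 \<and> K k *v 1 = 0"
    and "0 < Tbar" and "Tbar < Tmax"
    and stationary: "(cost A b x0 xg NK K \<Phi> has_real_derivative 0) (at Tbar)"
    and state: "is_state A b x0 NK K \<Phi> Tbar xbar"
    and adjoint: "is_adjoint_state A xg NK K \<Phi> Tbar xbar pbar"
    and "C > 0"
    and second_order: "\<And>x. is_linearized_state A b NK K \<Phi> Tbar xbar x \<Longrightarrow>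
      integral {0..1} (\<lambda>t. pbar t \<bullet>
          ((\<Sum>k=1..NK.
              Tbar *\<^sub>R (transpose (K k) *v
                second_derivative (\<Phi> k) (K k *v xbar t) (K k *v x t) (K k *v x t))
              + 2 *\<^sub>R (transpose (K k) *v
                (jacobian (\<Phi> k) (at (K k *v xbar t)) *v (K k *v x t))))
           + 2 *\<^sub>R (transpose A *v (A *v x t))))
        + x 1 \<bullet> x 1
      \<ge> C * (1 + (H1_norm x)\<^sup>2)"
  shows "\<forall>\<^sub>F T in at Tbar. cost A b x0 xg NK K \<Phi> Tbar < cost A b x0 xg NK K \<Phi> T"
proof -
  let ?f = "state_field A b NK K \<Phi>"
  let ?Df = "state_field_D A NK K \<Phi>"
  let ?D2f = "state_field_D2 NK K \<Phi>"
  have supp: "\<forall>j\<in>{1..Nw}. compact (closure {r. \<psi> j r \<noteq> 0})"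
    using \<open>\<forall>j\<in>{1..Nw}. compact (closure {r. \<psi> j r \<noteq> 0}) \<and> _ j\<close> by blast
  have \<Phi>: "\<Phi> k \<in> activation_space Nw \<psi>" if "k \<in> {1..NK}" for k
    using \<open>\<forall>k\<in>{1..NK}. \<Phi> k \<in> activation_space Nw \<psi>\<close> that by blast
  note smooth = activation_function_smooth[OF \<Phi> \<open>s \<ge> 2\<close> \<open>\<forall>j\<in>{1..Nw}. C_k s (\<psi> j)\<close> supp]
  obtain L where L: "smooth_lipschitz_field ?f ?Df ?D2f L"
    using smooth_lipschitz_state_field[where \<Phi> = \<Phi> and NK = NK and A = A and K = K and b = b]
      smooth by blast
  \<comment> \<open>Any horizon beyond \<open>Tbar\<close> would do: it has to cover a neighbourhood of \<open>Tbar\<close>.\<close>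
  define R where "R = Tbar + 1"
  have R: "0 \<le> R" and Tbar: "0 < Tbar" "0 \<le> Tbar" "Tbar \<le> R" "Tbar < R"
    using \<open>0 < Tbar\<close> by (auto simp: R_def)
  obtain X where X0: "X 0 = x0"
    and X: "\<And>t. t \<in> {0..R} \<Longrightarrow> (X has_vector_derivative ?f (X t)) (at t within {0..R})"
    using lipschitz_ode_exists[OF smooth_lipschitz_field.lipschitz[OF L] R, of x0] by blast
  have flow: "flow ?f ?Df ?D2f L X R"
    using L X by (intro flow.intro flow_axioms.intro)
  interpret flow ?f ?Df ?D2f L X R by (rule flow)
  have xbar: "xbar t = X (Tbar * t)" if "t \<in> {0..1}" for t
    by (rule states_eq_flow[OF flow X0 Tbar(2,3) state that])
  let ?z = "first_variation Tbar"
  let ?J = "\<lambda>T. 1 / 2 * (norm (X T - xg))\<^sup>2"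
  have cost: "\<forall>\<^sub>F T in nhds Tbar. cost A b x0 xg NK K \<Phi> T = ?J T"
  proof -
    have "\<forall>\<^sub>F T in nhds Tbar. T \<in> {0<..<R}"
      using Tbar by (intro eventually_nhds_in_open) auto
    then show ?thesis
      by (rule eventually_mono) (rule cost_eq_flow[OF flow X0], auto)
  qed
  have "(X Tbar - xg) \<bullet> ?f (X Tbar) = 0"
  proof (rule DERIV_unique)
    show "(?J has_real_derivative (X Tbar - xg) \<bullet> ?f (X Tbar)) (at Tbar)"
      by (rule terminal_cost_derivative) (use Tbar in auto)
    show "(?J has_real_derivative 0) (at Tbar)"
      using stationary DERIV_cong_ev[OF refl cost refl] by blast
  qed
  note stationary' = this

  have "is_linearized_state A b NK K \<Phi> Tbar xbar ?z"
    unfolding is_linearized_state_def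
  proof (intro conjI ballI C1_first_variation Tbar)
    show "?z 0 = 0" by (simp add: first_variation_def)
    fix t :: real assume t: "t \<in> {0<..<1}"
    have "at t within {0..1} = at t" using t by (intro at_within_interior) simp
    then have "(?z has_vector_derivative ?f (X (Tbar * t)) + Tbar *\<^sub>R ?Df (X (Tbar * t)) (?z t)) (at t)"
      using first_variation_has_derivative[OF Tbar(2,3), of t] t
      by (metis atLeastAtMost_iff greaterThanLessThan_iff less_imp_le)
    moreover have "xbar t = X (Tbar * t)" using t by (intro xbar) auto
    ultimately show "(?z has_vector_derivative
        (\<Sum>k=1..NK.
            - (Tbar *\<^sub>R (transpose (K k) *v
                (jacobian (\<Phi> k) (at (K k *v xbar t)) *v (K k *v ?z t))))
            - transpose (K k) *v \<Phi> k (K k *v xbar t))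
        - Tbar *\<^sub>R (transpose A *v (A *v ?z t))
        - transpose A *v (A *v xbar t - b)) (at t)"
      by (simp add: state_field_def state_field_D_def sum_subtractf sum_negf scaleR_sum_right
          algebra_simps)
  qed
  note so = second_order[OF this]

  have "((\<lambda>t. pbar t \<bullet> (Tbar *\<^sub>R ?D2f (X (Tbar * t)) (?z t) (?z t) + 2 *\<^sub>R ?Df (X (Tbar * t)) (?z t)))
    has_integral pbar 1 \<bullet> ?Df (X Tbar) (?f (X Tbar))) {0..1}"
  proof (rule adjoint_pairing[OF Tbar(2,3)])
    show "continuous_on {0..1} pbar"
      using adjoint unfolding is_adjoint_state_def C1_01_def by (metis continuous_on_vector_derivative)
    let ?p' = "\<lambda>t. (\<Sum>k=1..NK. Tbar *\<^sub>R (transpose (K k) *v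
            (jacobian (\<Phi> k) (at (K k *v xbar t)) *v (K k *v pbar t))))
        + Tbar *\<^sub>R (transpose A *v (A *v pbar t))"
    fix t :: real assume t: "t \<in> {0<..<1}"
    show "(pbar has_vector_derivative ?p' t) (at t)"
      using adjoint t unfolding is_adjoint_state_def by blast
    have "xbar t = X (Tbar * t)" using t by (intro xbar) auto
    then have p': "?p' t = Tbar *\<^sub>R ((\<Sum>k=1..NK. transpose (K k) *v
          (jacobian (\<Phi> k) (at (K k *v X (Tbar * t))) *v (K k *v pbar t)))
        + transpose A *v (A *v pbar t))"
      by (simp add: scaleR_sum_right scaleR_add_right)
    show "?p' t \<bullet> v = - Tbar * (pbar t \<bullet> ?Df (X (Tbar * t)) v)" for v
      unfolding p' inner_scaleR_left
      by (subst state_field_D_adjoint[where \<Phi> = \<Phi> and NK = NK, OF smooth(3)]) auto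
  qed
  \<comment> \<open>The integrand of the hypothesis is the negative of this one, because \<open>Df\<close> and \<open>D2f\<close>
    carry the minus sign of the state equation.\<close>
  from has_integral_neg[OF this]
  have "((\<lambda>t. pbar t \<bullet>
          ((\<Sum>k=1..NK.
              Tbar *\<^sub>R (transpose (K k) *v
                second_derivative (\<Phi> k) (K k *v xbar t) (K k *v ?z t) (K k *v ?z t))
              + 2 *\<^sub>R (transpose (K k) *v
                (jacobian (\<Phi> k) (at (K k *v xbar t)) *v (K k *v ?z t))))
           + 2 *\<^sub>R (transpose A *v (A *v ?z t))))
      has_integral - (pbar 1 \<bullet> ?Df (X Tbar) (?f (X Tbar)))) {0..1}"
  proof (rule has_integral_eq[rotated])
    fix t :: real assume "t \<in> {0..1}"
    then have "xbar t = X (Tbar * t)" by (rule xbar)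
    then show "- (pbar t \<bullet> (Tbar *\<^sub>R ?D2f (X (Tbar * t)) (?z t) (?z t)
          + 2 *\<^sub>R ?Df (X (Tbar * t)) (?z t))) = pbar t \<bullet>
          ((\<Sum>k=1..NK.
              Tbar *\<^sub>R (transpose (K k) *v
                second_derivative (\<Phi> k) (K k *v xbar t) (K k *v ?z t) (K k *v ?z t))
              + 2 *\<^sub>R (transpose (K k) *v
                (jacobian (\<Phi> k) (at (K k *v xbar t)) *v (K k *v ?z t))))
           + 2 *\<^sub>R (transpose A *v (A *v ?z t)))"
      unfolding inner_minus_right[symmetric]
      by (intro arg_cong[where f = "inner (pbar t)"])
         (simp add: state_field_D_def state_field_D2_def sum.distrib scaleR_sum_right algebra_simps)
  qed
  with so have "C * (1 + (H1_norm ?z)\<^sup>2)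
      \<le> - (pbar 1 \<bullet> ?Df (X Tbar) (?f (X Tbar))) + ?z 1 \<bullet> ?z 1"
    by (simp only: integral_unique)
  moreover have "pbar 1 = xg - X Tbar"
    using adjoint xbar[of 1] by (simp add: is_adjoint_state_def)
  moreover have "?z 1 = ?f (X Tbar)" by (simp add: first_variation_def)
  moreover have "0 < C * (1 + (H1_norm ?z)\<^sup>2)"
    using \<open>C > 0\<close> by (intro mult_pos_pos add_pos_nonneg) auto
  ultimately have positive: "0 < (X Tbar - xg) \<bullet> ?Df (X Tbar) (?f (X Tbar)) + ?f (X Tbar) \<bullet> ?f (X Tbar)"
    by (simp add: inner_diff_left)

  have "\<forall>\<^sub>F T in at Tbar. ?J Tbar < ?J T"
  proof (rule strict_local_min_if_second_derivative_pos)
    have "\<forall>\<^sub>F T in nhds Tbar. T \<in> {0<..<R}"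
      using Tbar by (intro eventually_nhds_in_open) auto
    then show "\<forall>\<^sub>F T in nhds Tbar. (?J has_real_derivative (X T - xg) \<bullet> ?f (X T)) (at T)"
      by (rule eventually_mono) (rule terminal_cost_derivative, auto)
    show "(X Tbar - xg) \<bullet> ?f (X Tbar) = 0" by (rule stationary')
    show "((\<lambda>T. (X T - xg) \<bullet> ?f (X T)) has_real_derivative
        (X Tbar - xg) \<bullet> ?Df (X Tbar) (?f (X Tbar)) + ?f (X Tbar) \<bullet> ?f (X Tbar)) (at Tbar)"
      by (rule terminal_cost_second_derivative) (use Tbar in auto)
  qed (rule positive)
  moreover have "\<forall>\<^sub>F T in at Tbar. cost A b x0 xg NK K \<Phi> T = ?J T"
    using cost by (auto simp: eventually_at_filter elim: eventually_mono)
  ultimately show ?thesis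
    by eventually_elim (use eventually_nhds_x_imp_x[OF cost] in simp)
qed

end
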